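(* Let $(p_a,Q_a)$ and $(p_b,Q_b)$ be two equivalent non-redundant $n$-CPH (Coxian phase-type of order $n$) distributions with $Q_a\neq Q_b$. Then $Q_a$ and $Q_b$ have the same but permuted diagonal entries: the vector $\mathrm{diag}(Q_b)=((Q_b)_{11},\dots,(Q_b)_{nn})$ is obtained from $\mathrm{diag}(Q_a)=((Q_a)_{11},\dots,(Q_a)_{nn})$ by a permutation of its components, and $\mathrm{diag}(Q_b)\neq\mathrm{diag}(Q_a)$.
   Context: An $n$-CPH (Coxian phase-type) distribution of order $n$ is given by a pair $(p,Q)$ with initial row vector $p=(1,0,\dots,0)\in\mathbb{R}^n$ and $n\times n$ upper bidiagonal generator $Q$ whose diagonal entries are $Q_{ii}=-(\lambda_i+\mu_i)$ for $1\le i\le n-1$ and $Q_{nn}=-\mu_n$, whose superdiagonal entries are $Q_{i,i+1}=\lambda_i$ for $1\le i\le n-1$, and whose other entries are zero. Here $\lambda_i>0$ for $1\le i\le n-1$ and $\mu_i\ge 0$ for all $i$, with $\mu_n>0$; in particular all diagonal and superdiagonal entries of $Q$ are non-zero. The absorbing rate vector is $q=(\mu_1,\dots,\mu_n)^T=-Q\mathbb{1}$, where $\mathbb{1}$ is the column vector of ones; the density is $f(t)=p e^{Qt}q$, $t\ge 0$, and its Laplace transform is the rational function $f^*(s)=p(sI-Q)^{-1}q$. Two $n$-CPH distributions $(p_a,Q_a)$ and $(p_b,Q_b)$ (with absorbing rate vectors $q_a,q_b$) are equivalent if their densities coincide: $p_ae^{Q_at}q_a=p_be^{Q_bt}q_b$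 for all $t\ge 0$. Non-redundant: the representation $(p,Q)$ of order $n$ is non-redundant if $f^*(s)$, written in lowest terms, has denominator of degree exactly $n$ (so that the distribution has the full $2n-1$ degrees of freedom, the degrees of freedom being the number of non-trivial coefficients of the Laplace transform). *)

theory Defs
  imports
    "HOL-Computational_Algebra.Polynomial_Factorial"
    "HOL-Computational_Algebra.Field_as_Ring"
    "HOL-Combinatorics.Permutations"
    "Jordan_Normal_Form.Char_Poly"
    "Jordan_Normal_Form.Gauss_Jordan_Elimination"
begin

text \<open>Indices start at 0: \<open>lam i\<close> and \<open>mu i\<close> are the rates usually written with index \<open>i + 1\<close>.
  The value \<open>lam (n - 1)\<close> is not used.\<close>

definition coxian_generator :: "nat \<Rightarrow> (nat \<Rightarrow> real) \<Rightarrow> (nat \<Rightarrow> real) \<Rightarrow> real mat" where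
  "coxian_generator n lam mu = mat n n (\<lambda>(i, j).
     if j = i then (if Suc i < n then - (lam i + mu i) else - mu i)
     else if j = Suc i then lam i
     else 0)"

definition is_cph :: "nat \<Rightarrow> real vec \<times> real mat \<Rightarrow> bool" where
  "is_cph n = (\<lambda>(p, Q). n \<ge> 1 \<and> p = unit_vec n 0 \<and>
     (\<exists>lam mu. (\<forall>i. Suc i < n \<longrightarrow> lam i > 0) \<and> (\<forall>i<n. mu i \<ge> 0) \<and> mu (n - 1) > 0 \<and>
        Q = coxian_generator n lam mu))"

definition exit_rates :: "real mat \<Rightarrow> real vec" where
  "exit_rates Q = - (Q *\<^sub>v vec (dim_row Q) (\<lambda>_. 1))"

lemma exit_rates_coxian_generator:
  "exit_rates (coxian_generator n lam mu) = vec n mu"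
proof (rule eq_vecI)
  fix i assume "i < dim_vec (vec n mu)"
  then have i: "i < n" by simp
  let ?f = "\<lambda>j. if j = i then (if Suc i < n then - (lam i + mu i) else - mu i)
     else if j = Suc i then lam i else 0"
  have "(\<Sum>j\<in>{0..<n}. ?f j) = (\<Sum>j\<in>{0..<n}. (if j = i then ?f i else 0) + (if j = Suc i then lam i else 0))"
    by (rule sum.cong) auto
  also have "\<dots> = - mu i"
    using i by (simp add: sum.distrib)
  finally have "(\<Sum>j\<in>{0..<n}. ?f j) = - mu i" .
  then show "exit_rates (coxian_generator n lam mu) $ i = vec n mu $ i"
    using i by (simp add: exit_rates_def coxian_generator_def scalar_prod_def)
qed (simp add: exit_rates_def coxian_generator_def)

text \<open>The library has no exponential for matrices of type \<open>mat\<close>; the power series is summed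
  entry by entry. It converges absolutely for every square matrix.\<close>

definition mat_exp :: "real mat \<Rightarrow> real mat" where
  "mat_exp A = mat (dim_row A) (dim_col A) (\<lambda>(i, j). \<Sum>k. (A ^\<^sub>m k) $$ (i, j) / fact k)"

lemma mat_exp_summable:
  fixes A :: "real mat"
  assumes A: "A \<in> carrier_mat n n" and ij: "i < n" "j < n"
  shows "summable (\<lambda>k. norm ((A ^\<^sub>m k) $$ (i, j) / fact k))"
proof -
  define B where "B = (\<Sum>i<n. \<Sum>j<n. \<bar>A $$ (i, j)\<bar>)"
  have B: "\<bar>A $$ (i, j)\<bar> \<le> (\<Sum>i<n. \<bar>A $$ (i, j)\<bar>)" "(\<Sum>i<n. \<bar>A $$ (i, j)\<bar>) \<le> B"
    if "i < n" "j < n" for i j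
    unfolding B_def using that
    by (auto intro!: member_le_sum sum_mono sum_nonneg)
  have B0: "B \<ge> 0"
    unfolding B_def by (intro sum_nonneg) auto
  have bound: "\<bar>(A ^\<^sub>m k) $$ (i, j)\<bar> \<le> B ^ k" if "i < n" "j < n" for i j k
    using that
  proof (induction k arbitrary: i j)
    case 0
    then show ?case using A by simp
  next
    case (Suc k)
    have P: "A ^\<^sub>m k \<in> carrier_mat n n" using A by simp
    have "(A ^\<^sub>m Suc k) $$ (i, j) = (\<Sum>l\<in>{0..<n}. (A ^\<^sub>m k) $$ (i, l) * A $$ (l, j))"
      using Suc.prems A P by (simp add: scalar_prod_def)
    also have "\<bar>\<dots>\<bar> \<le> (\<Sum>l\<in>{0..<n}. \<bar>(A ^\<^sub>m k) $$ (i, l) * A $$ (l, j)\<bar>)"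
      by (rule sum_abs)
    also have "\<dots> \<le> (\<Sum>l\<in>{0..<n}. B ^ k * \<bar>A $$ (l, j)\<bar>)"
      using Suc by (intro sum_mono) (auto simp: abs_mult intro!: mult_right_mono)
    also have "\<dots> = B ^ k * (\<Sum>l<n. \<bar>A $$ (l, j)\<bar>)"
      by (simp add: sum_distrib_left atLeast0LessThan)
    also have "\<dots> \<le> B ^ k * B"
      using B(2)[OF Suc.prems] B0 by (intro mult_left_mono) auto
    finally show ?case by (simp add: mult.commute)
  qed
  have "summable (\<lambda>k. B ^ k / fact k)"
    using summable_exp[of B] by (simp add: field_simps)
  then show ?thesis
    by (rule summable_comparison_test')
      (use bound[OF ij] in \<open>auto intro!: divide_right_mono simp: abs_divide\<close>)
qed

definition density :: "real vec \<times> real mat \<Rightarrow> real \<Rightarrow> real" where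
  "density = (\<lambda>(p, Q) t. p \<bullet> (mat_exp (t \<cdot>\<^sub>m Q) *\<^sub>v exit_rates Q))"

definition equivalent_cph :: "real vec \<times> real mat \<Rightarrow> real vec \<times> real mat \<Rightarrow> bool" where
  "equivalent_cph a b \<longleftrightarrow> (\<forall>t\<ge>0. density a t = density b t)"

text \<open>The Laplace transform is formed in the field \<open>real poly fract\<close> of real rational functions:
  \<open>char_poly_matrix Q\<close> is the polynomial matrix \<open>s I - Q\<close>, which is invertible over that field.\<close>

definition const_fract :: "real \<Rightarrow> real poly fract" where
  "const_fract c = to_fract [:c:]"

definition resolvent :: "real mat \<Rightarrow> real poly fract mat" where
  "resolvent Q = the (mat_inverse (map_mat to_fract (char_poly_matrix Q)))"

lemma resolvent_inverse:
  assumes Q: "Q \<in> carrier_mat n n"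
  shows "resolvent Q \<in> carrier_mat n n"
    and "map_mat to_fract (char_poly_matrix Q) * resolvent Q = 1\<^sub>m n"
    and "resolvent Q * map_mat to_fract (char_poly_matrix Q) = 1\<^sub>m n"
proof -
  interpret h: comm_ring_hom "to_fract :: real poly \<Rightarrow> real poly fract"
    by standard (auto simp: to_fract_add to_fract_mult)
  let ?M = "map_mat to_fract (char_poly_matrix Q) :: real poly fract mat"
  have M: "?M \<in> carrier_mat n n" using Q by simp
  have "det ?M = to_fract (char_poly Q)"
    by (simp add: char_poly_def)
  moreover have "char_poly Q \<noteq> 0"
    using degree_monic_char_poly[OF Q] by auto
  ultimately have "det ?M \<noteq> 0" by simp
  then have "?M \<in> Units (ring_mat TYPE(real poly fract) n ())"
    using det_non_zero_imp_unit[OF M] by simp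
  then obtain B where B: "mat_inverse ?M = Some B"
    using mat_inverse(1)[OF M, where b = "()"] by (cases "mat_inverse ?M") auto
  show "resolvent Q \<in> carrier_mat n n" "?M * resolvent Q = 1\<^sub>m n" "resolvent Q * ?M = 1\<^sub>m n"
    using mat_inverse(2)[OF M B] B by (auto simp: resolvent_def)
qed

definition laplace_transform :: "real vec \<times> real mat \<Rightarrow> real poly fract" where
  "laplace_transform = (\<lambda>(p, Q).
     map_vec const_fract p \<bullet> (resolvent Q *\<^sub>v map_vec const_fract (exit_rates Q)))"

text \<open>\<open>quot_of_fract\<close> yields numerator and denominator in lowest terms.\<close>

definition non_redundant :: "nat \<Rightarrow> real vec \<times> real mat \<Rightarrow> bool" where
  "non_redundant n a \<longleftrightarrow> degree (snd (quot_of_fract (laplace_transform a))) = n"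

end

theory Submission
  imports Defs
begin

text \<open>
  Everything is read off from the moments \<open>m k = p Q\<^sup>k q\<close>. They are the Taylor coefficients of the
  density (up to factorials), so equivalent distributions have the same moments, and hence the
  same linear functional \<open>L\<close> on polynomials with \<open>L (X\<^sup>k) = m k\<close>.

  Since \<open>Q\<close> is upper bidiagonal with diagonal entries \<open>d\<^sub>i\<close>,
  \<open>p (Q - d\<^sub>1 I) \<dots> (Q - d\<^sub>j I)\<close> is the multiple
  \<open>\<lambda>\<^sub>1 \<dots> \<lambda>\<^sub>j\<close> of the next unit row vector, and it vanishes for \<open>j = n\<close>. With
  \<open>\<chi>\<^sub>j = (X - d\<^sub>1) \<dots> (X - d\<^sub>j)\<close> this says that \<open>L \<chi>\<^sub>j = \<lambda>\<^sub>1 \<dots> \<lambda>\<^sub>j \<mu>\<^bsub>j+1\<^esub>\<close> for \<open>j < n\<close>,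
  and that \<open>L\<close> kills every multiple of \<open>\<chi>\<^sub>n\<close>
  (\<open>moment_functional_bidiag_newton\<close>, \<open>moment_functional_bidiag_annihilated\<close>).

  The diagonals agree up to order. If \<open>L\<close> kills all multiples of \<open>P\<close>, then \<open>P f\<^sup>*\<close> is a polynomial
  (\<open>laplace_annihilator\<close>): the formal expansion of \<open>f\<^sup>*\<close> at infinity is \<open>\<Sum> m k / s\<^bsup>k+1\<^esup>\<close>, and
  the condition says that \<open>P f\<^sup>*\<close> has no negative powers of \<open>s\<close>. So the reduced denominator of
  \<open>f\<^sup>*\<close> divides both characteristic polynomials, because \<open>L\<close> is the same for both
  distributions. Non-redundancy makes its degree \<open>n\<close>, so the two monic characteristic polynomials
  are equal, and so are the multisets of their roots, the diagonal entries.

  The diagonals differ as vectors. If they were equal, so would be the \<open>\<chi>\<^sub>j\<close>, hence the products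
  \<open>\<lambda>\<^sub>1 \<dots> \<lambda>\<^sub>j \<mu>\<^bsub>j+1\<^esub>\<close>. As the rates \<open>\<lambda>\<close> are positive, these products together with the diagonal
  entries \<open>- (\<lambda>\<^sub>j + \<mu>\<^sub>j)\<close> determine first \<open>\<mu>\<^sub>1\<close>, then \<open>\<lambda>\<^sub>1\<close>, then \<open>\<mu>\<^sub>2\<close>, and so on, so that the
  generators would be equal (\<open>equal_diagonal_and_moments_imp_equal\<close>).
\<close>

section \<open>Uniqueness of power series on the positive half-line\<close>

text \<open>The half-line \<open>t > 0\<close> instead of \<open>t \<ge> 0\<close> makes the induction below work: there the head can be
  removed by dividing by \<open>t\<close>. The head itself is the limit of the series at \<open>0\<close> from the right.\<close>

lemma powser_zero_imp_head_zero:
  fixes c :: "nat \<Rightarrow> real"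
  assumes "\<And>x. summable (\<lambda>k. c k * x ^ k)"
    and "\<And>t. t > 0 \<Longrightarrow> (\<Sum>k. c k * t ^ k) = 0"
  shows "c 0 = 0"
proof -
  have "isCont (\<lambda>x. \<Sum>k. c k * x ^ k) 0"
    by (rule isCont_powser_converges_everywhere[OF assms(1)])
  then have "((\<lambda>x. \<Sum>k. c k * x ^ k) \<longlongrightarrow> (\<Sum>k. c k * 0 ^ k)) (at_right 0)"
    unfolding isCont_def using filterlim_at_split by blast
  moreover have "((\<lambda>x. \<Sum>k. c k * x ^ k) \<longlongrightarrow> 0) (at_right 0)"
    by (rule tendsto_eventually) (use assms(2) in \<open>simp add: eventually_at_filter\<close>)
  ultimately have "(\<Sum>k. c k * 0 ^ k) = 0"
    using tendsto_unique trivial_limit_at_right_real by blast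
  then show ?thesis by (simp only: powser_zero)
qed

lemma powser_zero_imp_coeffs_zero:
  fixes c :: "nat \<Rightarrow> real"
  assumes "\<And>x. summable (\<lambda>k. c k * x ^ k)"
    and "\<And>t. t > 0 \<Longrightarrow> (\<Sum>k. c k * t ^ k) = 0"
  shows "c k = 0"
  using assms
proof (induction k arbitrary: c)
  case (0 c)
  then show ?case by (rule powser_zero_imp_head_zero)
next
  case (Suc k c)
  have c0: "c 0 = 0"
    using Suc.prems by (rule powser_zero_imp_head_zero)
  have "(\<Sum>k. c (Suc k) * t ^ k) = 0" if "t > 0" for t
    using powser_split_head(1)[OF Suc.prems(1), of t] Suc.prems(2)[OF that] that c0 by simp
  then show ?case
    using Suc.IH[of "\<lambda>k. c (Suc k)"] powser_split_head(3)[OF Suc.prems(1)] by blast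
qed

section \<open>Linear functionals on polynomials given by moments\<close>

definition moment_functional :: "(nat \<Rightarrow> 'a::comm_ring_1) \<Rightarrow> 'a poly \<Rightarrow> 'a" where
  "moment_functional m p = (\<Sum>k\<le>degree p. coeff p k * m k)"

lemma moment_functional_eq_sum:
  assumes "degree p \<le> N"
  shows "moment_functional m p = (\<Sum>k\<le>N. coeff p k * m k)"
  unfolding moment_functional_def using assms
  by (intro sum.mono_neutral_left) (auto simp: coeff_eq_0)

lemma moment_functional_0 [simp]: "moment_functional m 0 = 0"
  by (simp add: moment_functional_def)

lemma moment_functional_1 [simp]: "moment_functional m 1 = m 0"
  by (simp add: moment_functional_def)

lemma moment_functional_add:
  "moment_functional m (p + q) = moment_functional m p + moment_functional m q"
proof -
  let ?N = "max (degree p) (degree q)"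
  have "degree (p + q) \<le> ?N" by (rule degree_add_le_max)
  then show ?thesis
    by (simp add: moment_functional_eq_sum[where N = ?N] algebra_simps sum.distrib)
qed

lemma moment_functional_smult: "moment_functional m (Polynomial.smult c p) = c * moment_functional m p"
  using moment_functional_eq_sum[OF degree_smult_le]
  by (simp add: moment_functional_def sum_distrib_left mult.assoc)

lemma moment_functional_pCons:
  "moment_functional m (pCons a p) = a * m 0 + moment_functional (\<lambda>k. m (Suc k)) p"
proof -
  have deg: "degree (pCons a p) \<le> Suc (degree p)" by (rule degree_pCons_le)
  show ?thesis
    unfolding moment_functional_eq_sum[OF deg] sum.atMost_Suc_shift
    by (simp add: moment_functional_def)
qed

lemma moment_functional_lincomb:
  "moment_functional (\<lambda>k. a * u k + b * v k) p = a * moment_functional u p + b * moment_functional v p"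
  by (simp add: moment_functional_def algebra_simps sum.distrib sum_distrib_left)

section \<open>Monic polynomials with prescribed roots\<close>

text \<open>This is the characteristic polynomial of a triangular matrix with diagonal \<open>d\<close>. Letting \<open>n\<close>
  vary over the leading blocks gives the Newton basis for the nodes \<open>d 0, d 1, \<dots>\<close>.\<close>

definition diag_char_poly :: "nat \<Rightarrow> (nat \<Rightarrow> 'a::comm_ring_1) \<Rightarrow> 'a poly" where
  "diag_char_poly n d = (\<Prod>i<n. [:- d i, 1:])"

lemma diag_char_poly_0 [simp]: "diag_char_poly 0 d = 1"
  by (simp add: diag_char_poly_def)

lemma diag_char_poly_Suc: "diag_char_poly (Suc j) d = diag_char_poly j d * [:- d j, 1:]"
  by (simp add: diag_char_poly_def)

lemma degree_diag_char_poly [simp]: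
  fixes d :: "nat \<Rightarrow> 'a::idom"
  shows "degree (diag_char_poly n d) = n"
  by (simp add: diag_char_poly_def degree_prod_eq_sum_degree)

lemma monic_diag_char_poly [simp]:
  fixes d :: "nat \<Rightarrow> 'a::idom"
  shows "coeff (diag_char_poly n d) n = 1"
proof -
  have "lead_coeff (diag_char_poly n d) = 1"
    unfolding diag_char_poly_def by (simp add: lead_coeff_prod del: pCons_one)
  then show ?thesis by simp
qed

lemma map_poly_diag_char_poly:
  assumes "comm_ring_hom h"
  shows "map_poly h (diag_char_poly n d) = diag_char_poly n (h \<circ> d)"
proof -
  interpret comm_ring_hom h by fact
  interpret p: map_poly_comm_ring_hom h ..
  show ?thesis
    by (simp add: diag_char_poly_def p.hom_prod map_poly_pCons hom_distribs)
qed

lemma diag_char_poly_eq_imp_mset_eq: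
  fixes d e :: "nat \<Rightarrow> 'a::idom"
  assumes "diag_char_poly n d = diag_char_poly n e"
  shows "mset (map d [0..<n]) = mset (map e [0..<n])"
proof -
  have "proots (diag_char_poly n d) = mset (map d [0..<n])" for d :: "nat \<Rightarrow> 'a"
    by (simp add: diag_char_poly_def proots_prod flip: atLeast0LessThan)
      (simp add: sum_unfold_sum_mset)
  then show ?thesis using assms by metis
qed

lemma monic_eq_if_common_full_degree_divisor:
  fixes p q e :: "real poly"
  assumes "e dvd p" "e dvd q" "degree p = degree e" "degree q = degree e"
    and "lead_coeff p = 1" "lead_coeff q = 1"
  shows "p = q"
proof -
  have "p = Polynomial.smult (inverse (lead_coeff e)) e" if "e dvd p" "degree p = degree e" "lead_coeff p = 1" for p
  proof -
    obtain k where k: "p = e * k" using \<open>e dvd p\<close> by (rule dvdE)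
    have "p \<noteq> 0" using that(3) by auto
    then have "degree k = 0" using that(2) k by (auto simp: degree_mult_eq)
    then obtain c where "k = [:c:]" by (rule degree_eq_zeroE)
    then have p: "p = Polynomial.smult c e" using k by simp
    then have "c * lead_coeff e = 1" using that(3) by (cases "c = 0") simp_all
    then show ?thesis using p by (metis inverse_unique mult.commute)
  qed
  then show ?thesis using assms by metis
qed

section \<open>Bidiagonal recurrences\<close>

text \<open>The action of an upper bidiagonal matrix on column vectors, for vectors indexed by all of
  \<open>nat\<close>. A matrix of order \<open>n\<close> is the case \<open>l (n - 1) = 0\<close>, which cuts the coordinates below \<open>n\<close> off
  from the others; then no index has to be bounded in the recurrences.\<close>

definition bidiag :: "(nat \<Rightarrow> 'a::comm_ring_1) \<Rightarrow> (nat \<Rightarrow> 'a) \<Rightarrow> (nat \<Rightarrow> 'a) \<Rightarrow> nat \<Rightarrow> 'a" where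
  "bidiag d l v i = d i * v i + l i * v (Suc i)"

lemma moment_functional_bidiag_linear_factor:
  "moment_functional (\<lambda>k. (bidiag d l ^^ k) v i) ([:- d i, 1:] * p)
    = l i * moment_functional (\<lambda>k. (bidiag d l ^^ k) v (Suc i)) p"
proof -
  let ?u = "\<lambda>i k. (bidiag d l ^^ k) v i"
  have "[:- d i, 1:] * p = Polynomial.smult (- d i) p + pCons 0 p" by simp
  moreover have "moment_functional (\<lambda>k. ?u i (Suc k)) p
      = d i * moment_functional (?u i) p + l i * moment_functional (?u (Suc i)) p"
    by (simp add: bidiag_def moment_functional_lincomb)
  ultimately show ?thesis
    by (simp only: moment_functional_add moment_functional_smult moment_functional_pCons) simp
qed

text \<open>The row vector counterpart: multiplying the first unit row by \<open>A - d 0, \<dots>, A - d (j - 1)\<close>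
  moves it along the superdiagonal to the unit row \<open>j\<close>.\<close>

lemma moment_functional_bidiag_newton:
  "moment_functional (\<lambda>k. (bidiag d l ^^ k) v 0) (diag_char_poly j d * p)
    = (\<Prod>i<j. l i) * moment_functional (\<lambda>k. (bidiag d l ^^ k) v j) p"
proof (induction j arbitrary: p)
  case (Suc j)
  show ?case
    using Suc[of "[:- d j, 1:] * p"] moment_functional_bidiag_linear_factor[of d l v j p]
    by (simp add: diag_char_poly_Suc mult_ac del: mult_pCons_left mult_pCons_right)
qed simp

text \<open>The part of Cayley-Hamilton that matters here; the factor \<open>l (n - 1) = 0\<close> does the
  annihilation.\<close>

lemma moment_functional_bidiag_annihilated:
  assumes "l (n - 1) = 0" "n \<ge> 1"
  shows "moment_functional (\<lambda>k. (bidiag d l ^^ k) v 0) (diag_char_poly n d * p) = 0"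
proof -
  have "(\<Prod>i<n. l i) = 0" using assms by (intro prod_zero) (auto intro!: bexI[of _ "n - 1"])
  then show ?thesis by (simp add: moment_functional_bidiag_newton)
qed

lemma hom_funpow_bidiag:
  assumes "comm_ring_hom h"
  shows "h ((bidiag d l ^^ k) v i) = (bidiag (h \<circ> d) (h \<circ> l) ^^ k) (h \<circ> v) i"
proof -
  interpret comm_ring_hom h by fact
  show ?thesis
    by (induction k arbitrary: i) (simp_all add: bidiag_def hom_distribs)
qed

text \<open>The assumption says \<open>(s - A) x = q\<close>, so \<open>A\<^bsup>k+1\<^esup> x = s A\<^sup>k x - A\<^sup>k q\<close> since \<open>A\<close> commutes with
  \<open>s\<close>.\<close>

lemma funpow_bidiag_resolvent:
  assumes "\<And>i. i < n \<Longrightarrow> bidiag d l x i = s * x i - q i"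
    and "l (n - 1) = 0" and "i < n"
  shows "(bidiag d l ^^ Suc k) x i = s * (bidiag d l ^^ k) x i - (bidiag d l ^^ k) q i"
  using assms(3)
proof (induction k arbitrary: i)
  case 0
  then show ?case by (simp add: assms(1))
next
  case (Suc k)
  let ?u = "\<lambda>k. (bidiag d l ^^ k)"
  have step: "?u (Suc k) v i = d i * ?u k v i + l i * ?u k v (Suc i)" for k v
    by (simp add: bidiag_def)
  have "l i * ?u (Suc k) x (Suc i) = l i * (s * ?u k x (Suc i) - ?u k q (Suc i))"
    using Suc.IH[of "Suc i"] Suc.prems assms(2) by (cases "Suc i < n") (auto simp: less_Suc_eq not_less le_Suc_eq)
  then have "?u (Suc (Suc k)) x i
      = d i * (s * ?u k x i - ?u k q i) + l i * (s * ?u k x (Suc i) - ?u k q (Suc i))"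
    by (simp only: step[of "Suc k"] Suc.IH[OF Suc.prems])
  also have "\<dots> = s * ?u (Suc k) x i - ?u (Suc k) q i"
    by (simp only: step) (simp add: algebra_simps)
  finally show ?case .
qed

section \<open>Resolvents and annihilating polynomials\<close>

text \<open>In this section \<open>X k\<close> stands for \<open>(A\<^sup>k x) 0\<close>, where \<open>x = (s - A)\<^bsup>-1\<^esup> q\<close>, and \<open>M k\<close> for the moment
  \<open>(A\<^sup>k q) 0\<close>.\<close>

lemma moment_functional_resolvent_pCons:
  assumes "\<And>k. X (Suc k) = s * X k - M k"
  shows "moment_functional X (pCons a p) = a * X 0 + s * moment_functional X p - moment_functional M p"
  using moment_functional_lincomb[of s X "-1" M p]
  by (simp add: moment_functional_pCons assms)

text \<open>If the moments are killed by all multiples of \<open>p\<close>, then the first row of \<open>p (A)\<close> sees \<open>A\<close> act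
  on the resolvent vector as multiplication by \<open>s\<close>.\<close>

lemma moment_functional_resolvent_mult:
  assumes "\<And>k. X (Suc k) = s * X k - M k"
    and "\<And>r. moment_functional M (p * r) = 0"
  shows "moment_functional X (p * r) = poly r s * moment_functional X p"
proof (induction r)
  case (pCons a r)
  have "moment_functional X (pCons 0 (p * r)) = s * moment_functional X (p * r)"
    using moment_functional_resolvent_pCons[of X s M 0 "p * r"] assms by simp
  then show ?case
    using pCons.IH
    by (simp add: moment_functional_add moment_functional_smult algebra_simps)
qed simp

text \<open>With the characteristic polynomial as \<open>c\<close>, this turns annihilation of the moments into
  annihilation of the resolvent vector.\<close>

lemma moment_functional_resolvent_eq_0:
  fixes s :: "'a::idom"
  assumes "\<And>k. X (Suc k) = s * X k - M k"
    and "\<And>r. moment_functional M (p * r) = 0"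
    and "moment_functional X (p * c) = 0" and "poly c s \<noteq> 0"
  shows "moment_functional X p = 0"
  using moment_functional_resolvent_mult[OF assms(1,2), of c] assms(3,4) by simp

lemma const_fract_0 [simp]: "const_fract 0 = 0"
  by (simp add: const_fract_def)

lemma const_fract_1 [simp]: "const_fract 1 = 1"
  by (simp only: const_fract_def pCons_one to_fract_1)

lemma const_fract_hom: "comm_ring_hom const_fract"
  by standard (simp_all, simp_all add: const_fract_def flip: to_fract_add to_fract_mult)

text \<open>The indeterminate \<open>s\<close> of the Laplace transform is the element \<open>to_fract [:0, 1:]\<close>.\<close>

lemma poly_const_fract_indeterminate:
  "poly (map_poly const_fract p) (to_fract [:0, 1:]) = to_fract p"
proof (induction p)
  case (pCons a p)
  interpret comm_ring_hom const_fract by (rule const_fract_hom)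
  have "pCons a p = [:a:] + [:0,1:] * p" by simp
  then have "to_fract (pCons a p) = const_fract a + to_fract [:0,1:] * to_fract p"
    unfolding const_fract_def by (metis to_fract_add to_fract_mult)
  then show ?case using pCons by (simp add: map_poly_pCons)
qed simp

text \<open>Replacing \<open>A\<close> by \<open>s\<close> in \<open>p (A) x\<close> costs only a polynomial in \<open>s\<close>, because \<open>p (s) - p (A)\<close> is
  divisible by \<open>s - A\<close>, which takes \<open>x\<close> to the constant vector \<open>q\<close>.\<close>

lemma moment_functional_resolvent_polynomial_part:
  assumes "\<And>k. X (Suc k) = to_fract [:0, 1:] * X k - const_fract (m k)"
  shows "\<exists>c. moment_functional X (map_poly const_fract p) = to_fract p * X 0 - to_fract c"
proof (induction p)
  case 0
  show ?case by (auto intro: exI[of _ 0])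
next
  case (pCons a p)
  interpret comm_ring_hom const_fract by (rule const_fract_hom)
  let ?s = "to_fract [:0, 1:]"
  obtain c where c: "moment_functional X (map_poly const_fract p) = to_fract p * X 0 - to_fract c"
    using pCons.IH by blast
  have m: "moment_functional (\<lambda>k. const_fract (m k)) (map_poly const_fract p)
      = to_fract [:moment_functional m p:]"
    unfolding moment_functional_eq_sum[OF degree_map_poly_le]
    by (simp add: moment_functional_def hom_distribs flip: const_fract_def)
  have "pCons a p = [:a:] + [:0,1:] * p" by simp
  then have p: "to_fract (pCons a p) = const_fract a + ?s * to_fract p"
    unfolding const_fract_def by (metis to_fract_add to_fract_mult)
  have map_pCons: "map_poly const_fract (pCons a p) = pCons (const_fract a) (map_poly const_fract p)"
    by (cases "a = 0 \<and> p = 0") (auto simp: map_poly_pCons)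
  have "moment_functional X (map_poly const_fract (pCons a p))
     = to_fract (pCons a p) * X 0 - to_fract ([:0,1:] * c + [:moment_functional m p:])"
    unfolding map_pCons moment_functional_resolvent_pCons[of X ?s, OF assms] c m p to_fract_add to_fract_mult
    by (simp add: algebra_simps)
  then show ?case by blast
qed

lemma denominator_dvd_annihilator:
  fixes p :: "real poly"
  assumes "to_fract p * x = to_fract c"
  shows "snd (quot_of_fract x) dvd p"
proof -
  define a b where "a = fst (quot_of_fract x)" and "b = snd (quot_of_fract x)"
  have b: "b \<noteq> 0" and x: "x = Fract a b" and "coprime a b"
    by (simp_all add: a_def b_def coprime_quot_of_fract)
  have "p * a = c * b"
    using assms b by (simp add: x to_fract_def eq_fract)
  then have "b dvd p * a" by simp
  then show ?thesis
    using \<open>coprime a b\<close> by (simp add: b_def coprime_commute coprime_dvd_mult_left_iff)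
qed

section \<open>Bidiagonal matrices\<close>

definition bidiag_mat :: "nat \<Rightarrow> (nat \<Rightarrow> 'a::comm_ring_1) \<Rightarrow> (nat \<Rightarrow> 'a) \<Rightarrow> 'a mat" where
  "bidiag_mat n d l = mat n n (\<lambda>(i, j). if j = i then d i else if j = Suc i then l i else 0)"

lemma bidiag_mat_carrier [simp]: "bidiag_mat n d l \<in> carrier_mat n n"
  by (simp add: bidiag_mat_def)

lemma bidiag_mat_dim [simp]: "dim_row (bidiag_mat n d l) = n" "dim_col (bidiag_mat n d l) = n"
  by (simp_all add: bidiag_mat_def)

lemma bidiag_mat_mult_vec:
  assumes "l (n - 1) = 0"
  shows "bidiag_mat n d l *\<^sub>v vec n v = vec n (bidiag d l v)"
proof (rule eq_vecI)
  fix i assume "i < dim_vec (vec n (bidiag d l v))"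
  then have i: "i < n" by simp
  have "(bidiag_mat n d l *\<^sub>v vec n v) $ i
      = (\<Sum>j\<in>{0..<n}. (if j = i then d i * v i else 0) + (if j = Suc i then l i * v (Suc i) else 0))"
    using i by (auto simp: bidiag_mat_def scalar_prod_def intro!: sum.cong)
  also have "\<dots> = d i * v i + (if Suc i < n then l i * v (Suc i) else 0)"
    using i by (simp add: sum.distrib)
  also have "\<dots> = bidiag d l v i"
  proof (cases "Suc i < n")
    case False
    then have "i = n - 1" using i by simp
    then show ?thesis using False assms by (simp add: bidiag_def)
  qed (simp add: bidiag_def)
  finally show "(bidiag_mat n d l *\<^sub>v vec n v) $ i = vec n (bidiag d l v) $ i"
    using i by simp
qed simp

lemma bidiag_mat_pow_mult_vec:
  assumes "l (n - 1) = 0"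
  shows "(bidiag_mat n d l ^\<^sub>m k) *\<^sub>v vec n v = vec n ((bidiag d l ^^ k) v)"
proof (induction k arbitrary: v)
  case (Suc k)
  have "(bidiag_mat n d l ^\<^sub>m Suc k) *\<^sub>v vec n v
      = (bidiag_mat n d l ^\<^sub>m k) *\<^sub>v (bidiag_mat n d l *\<^sub>v vec n v)"
    by (simp add: assoc_mult_mat_vec[of _ n n _ n])
  then show ?case
    by (simp add: bidiag_mat_mult_vec[where l = l, OF assms] Suc funpow_swap1)
qed simp

lemma char_poly_matrix_bidiag_mat:
  "map_mat to_fract (char_poly_matrix (bidiag_mat n d l))
    = bidiag_mat n (\<lambda>i. to_fract [:0, 1:] - const_fract (d i)) (\<lambda>i. - const_fract (l i))"
proof (rule eq_matI, goal_cases)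
  case (1 i j)
  have "pCons (- d i) 1 = [:0, 1:] - [:d i:]" "[:- l i:] = - [:l i:]"
    by (simp_all add: one_pCons)
  then have "to_fract (pCons (- d i) 1) = to_fract [:0, 1:] - const_fract (d i)"
    "to_fract [:- l i:] = - const_fract (l i)"
    by (simp_all only: const_fract_def to_fract_diff to_fract_uminus)
  then show ?case
    using 1 by (auto simp: char_poly_matrix_def bidiag_mat_def)
qed (simp_all add: char_poly_matrix_def)

lemma pow_mat_smult:
  fixes A :: "'a::comm_ring_1 mat"
  assumes "A \<in> carrier_mat n n"
  shows "(t \<cdot>\<^sub>m A) ^\<^sub>m k = t ^ k \<cdot>\<^sub>m (A ^\<^sub>m k)"
proof (induction k)
  case (Suc k)
  have P: "A ^\<^sub>m k \<in> carrier_mat n n" using assms by simp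
  show ?case
    using assms P by (simp add: Suc mult_smult_assoc_mat[of _ n n _ n] mult_smult_distrib[of _ n n _ n])
      (auto intro!: eq_matI simp: mult_ac)
qed (use assms in auto)

section \<open>Coxian distributions\<close>

text \<open>The parametrisation by the diagonal \<open>d\<close>, the superdiagonal \<open>l\<close> and the exit rates \<open>mu\<close>,
  with the normalisation \<open>l (n - 1) = 0\<close> that closes the recurrences.\<close>

definition coxian_params :: "nat \<Rightarrow> real vec \<times> real mat \<Rightarrow> (nat \<Rightarrow> real) \<Rightarrow> (nat \<Rightarrow> real) \<Rightarrow> (nat \<Rightarrow> real) \<Rightarrow> bool"
  where "coxian_params n a d l mu \<longleftrightarrow> n \<ge> 1 \<and> a = (unit_vec n 0, bidiag_mat n d l) \<and> l (n - 1) = 0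
    \<and> (\<forall>i. Suc i < n \<longrightarrow> l i > 0) \<and> (\<forall>i<n. d i = - (l i + mu i))
    \<and> exit_rates (bidiag_mat n d l) = vec n mu"

lemma is_cph_imp_coxian_params:
  assumes "is_cph n a"
  obtains d l mu where "coxian_params n a d l mu"
proof -
  obtain lam mu where n: "n \<ge> 1" and a: "a = (unit_vec n 0, coxian_generator n lam mu)"
    and pos: "\<And>i. Suc i < n \<Longrightarrow> lam i > 0"
    using assms by (auto simp: is_cph_def split: prod.splits)
  define l where "l i = (if Suc i < n then lam i else 0)" for i
  have Q: "coxian_generator n lam mu = bidiag_mat n (\<lambda>i. - (l i + mu i)) l"
    by (auto simp: coxian_generator_def bidiag_mat_def l_def intro!: eq_matI)
  have "coxian_params n a (\<lambda>i. - (l i + mu i)) l mu"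
    using n pos exit_rates_coxian_generator[of n lam mu]
    by (simp add: coxian_params_def a Q) (simp add: l_def)
  then show ?thesis by (rule that)
qed

definition cph_moment :: "(nat \<Rightarrow> real) \<Rightarrow> (nat \<Rightarrow> real) \<Rightarrow> (nat \<Rightarrow> real) \<Rightarrow> nat \<Rightarrow> real" where
  "cph_moment d l mu k = (bidiag d l ^^ k) mu 0"

text \<open>The density is the exponential generating function of the moments.\<close>

lemma density_sums:
  assumes "coxian_params n a d l mu"
  shows "(\<lambda>k. cph_moment d l mu k / fact k * t ^ k) sums density a t"
proof -
  let ?A = "bidiag_mat n d l"
  have n: "0 < n" and a: "a = (unit_vec n 0, ?A)" and l: "l (n - 1) = 0"
    and q: "exit_rates ?A = vec n mu"
    using assms by (auto simp: coxian_params_def)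
  have A: "?A \<in> carrier_mat n n" "t \<cdot>\<^sub>m ?A \<in> carrier_mat n n" by simp_all
  have entry: "(\<lambda>k. (?A ^\<^sub>m k) $$ (0, j) / fact k * t ^ k) sums mat_exp (t \<cdot>\<^sub>m ?A) $$ (0, j)"
    if j: "j < n" for j
  proof -
    have "(\<lambda>k. ((t \<cdot>\<^sub>m ?A) ^\<^sub>m k) $$ (0, j) / fact k) sums (\<Sum>k. ((t \<cdot>\<^sub>m ?A) ^\<^sub>m k) $$ (0, j) / fact k)"
      by (rule summable_sums[OF summable_norm_cancel[OF mat_exp_summable[OF A(2) n j]]])
    then show ?thesis
      using n j by (simp add: mat_exp_def pow_mat_smult[OF A(1)] mult_ac)
  qed
  have "density a t = (\<Sum>j\<in>{0..<n}. mat_exp (t \<cdot>\<^sub>m ?A) $$ (0, j) * mu j)"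
  proof -
    let ?w = "mat_exp (t \<cdot>\<^sub>m ?A) *\<^sub>v vec n mu"
    have E: "mat_exp (t \<cdot>\<^sub>m ?A) \<in> carrier_mat n n"
      unfolding mat_exp_def by (intro carrier_matI) simp_all
    then have w: "?w \<in> carrier_vec n" by (rule mult_mat_vec_carrier) simp
    have "density a t = unit_vec n 0 \<bullet> ?w"
      by (simp only: density_def a q prod.case)
    also have "\<dots> = ?w $ 0"
      using w n by (rule scalar_prod_left_unit)
    also have "\<dots> = (\<Sum>j\<in>{0..<n}. mat_exp (t \<cdot>\<^sub>m ?A) $$ (0, j) * mu j)"
      using E n by (simp add: scalar_prod_def)
    finally show ?thesis .
  qed
  moreover have "(\<Sum>j\<in>{0..<n}. (?A ^\<^sub>m k) $$ (0, j) / fact k * t ^ k * mu j)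
      = cph_moment d l mu k / fact k * t ^ k" for k
  proof -
    have "cph_moment d l mu k = ((?A ^\<^sub>m k) *\<^sub>v vec n mu) $ 0"
      using n by (simp add: cph_moment_def bidiag_mat_pow_mult_vec[where l = l, OF l])
    also have "\<dots> = (\<Sum>j\<in>{0..<n}. (?A ^\<^sub>m k) $$ (0, j) * mu j)"
      using n by (simp add: scalar_prod_def)
    finally show ?thesis
      by (simp add: sum_distrib_left sum_distrib_right sum_divide_distrib mult_ac)
  qed
  moreover have "(\<lambda>k. \<Sum>j\<in>{0..<n}. (?A ^\<^sub>m k) $$ (0, j) / fact k * t ^ k * mu j)
      sums (\<Sum>j\<in>{0..<n}. mat_exp (t \<cdot>\<^sub>m ?A) $$ (0, j) * mu j)"
    by (intro sums_sum sums_mult2 entry) simp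
  ultimately show ?thesis by simp
qed

lemma equivalent_cph_imp_moments_eq:
  assumes a: "coxian_params n a da la mua" and b: "coxian_params n b db lb mub"
    and "equivalent_cph a b"
  shows "cph_moment da la mua = cph_moment db lb mub"
proof
  fix k
  let ?c = "\<lambda>k. cph_moment da la mua k / fact k - cph_moment db lb mub k / fact k"
  have sums: "(\<lambda>k. ?c k * t ^ k) sums (density a t - density b t)" for t
    using sums_diff[OF density_sums[OF a, of t] density_sums[OF b, of t]]
    by (simp add: left_diff_distrib)
  have "?c k = 0"
  proof (rule powser_zero_imp_coeffs_zero)
    show "summable (\<lambda>k. ?c k * x ^ k)" for x
      using sums by (rule sums_summable)
    show "(\<Sum>k. ?c k * t ^ k) = 0" if "t > 0" for t
      using sums_unique[OF sums[of t]] assms(3) that by (simp add: equivalent_cph_def)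
  qed
  then show "cph_moment da la mua k = cph_moment db lb mub k" by simp
qed

text \<open>The value \<open>p (A) x\<close> at the first coordinate vanishes by \<open>moment_functional_resolvent_eq_0\<close>,
  where the generator's own characteristic polynomial serves as the second factor. This value differs
  from \<open>p\<close> times the Laplace transform by a polynomial only.\<close>

lemma laplace_annihilator:
  assumes b: "coxian_params n b d l mu"
    and kills: "\<And>r. moment_functional (\<lambda>k. const_fract (cph_moment d l mu k)) (map_poly const_fract p * r) = 0"
  shows "\<exists>c. to_fract p * laplace_transform b = to_fract c"
proof -
  let ?A = "bidiag_mat n d l" and ?s = "to_fract [:0, 1:] :: real poly fract"
  let ?cd = "const_fract \<circ> d" and ?cl = "const_fract \<circ> l" and ?cm = "const_fract \<circ> mu"
  have n: "n \<ge> 1" and b: "b = (unit_vec n 0, ?A)" and l: "l (n - 1) = 0"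
    and q: "exit_rates ?A = vec n mu"
    using b by (auto simp: coxian_params_def)
  define x where "x i = (resolvent ?A *\<^sub>v vec n ?cm) $ i" for i
  have R: "resolvent ?A \<in> carrier_mat n n"
    and RI: "map_mat to_fract (char_poly_matrix ?A) * resolvent ?A = 1\<^sub>m n"
    using resolvent_inverse[of ?A n] by auto
  have x: "resolvent ?A *\<^sub>v vec n ?cm = vec n x"
    using R by (auto simp: x_def intro!: eq_vecI)
  have cq: "map_vec const_fract (vec n mu) = vec n ?cm"
    by (auto intro!: eq_vecI)
  have cp: "map_vec const_fract (unit_vec n 0) = unit_vec n 0"
    by (auto simp: unit_vec_def intro!: eq_vecI)
  have laplace: "laplace_transform b = x 0"
    using n by (simp add: laplace_transform_def b q cq cp x scalar_prod_left_unit[of _ n])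
  have "vec n ?cm = map_mat to_fract (char_poly_matrix ?A) *\<^sub>v vec n x"
    using assoc_mult_mat_vec[of "map_mat to_fract (char_poly_matrix ?A)" n n "resolvent ?A" n "vec n ?cm"]
      R by (simp add: RI x)
  also have "\<dots> = vec n (bidiag (\<lambda>i. ?s - const_fract (d i)) (\<lambda>i. - const_fract (l i)) x)"
    unfolding char_poly_matrix_bidiag_mat by (rule bidiag_mat_mult_vec) (use l in simp)
  finally have res: "bidiag ?cd ?cl x i = ?s * x i - ?cm i" if "i < n" for i
    using that by (auto simp: vec_eq_iff bidiag_def algebra_simps dest!: spec[of _ i])
  let ?X = "\<lambda>k. (bidiag ?cd ?cl ^^ k) x 0"
  from res have X: "(bidiag ?cd ?cl ^^ Suc k) x 0
      = ?s * (bidiag ?cd ?cl ^^ k) x 0 - const_fract (cph_moment d l mu k)" for k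
    using funpow_bidiag_resolvent[of n ?cd ?cl x ?s ?cm 0 k] n l
    by (simp add: cph_moment_def hom_funpow_bidiag[OF const_fract_hom])
  have "moment_functional (\<lambda>k. (bidiag ?cd ?cl ^^ k) x 0) (map_poly const_fract p) = 0"
  proof (rule moment_functional_resolvent_eq_0[where X = ?X, OF X kills])
    show "moment_functional (\<lambda>k. (bidiag ?cd ?cl ^^ k) x 0)
        (map_poly const_fract p * diag_char_poly n ?cd) = 0"
      using moment_functional_bidiag_annihilated[of ?cl n ?cd x "map_poly const_fract p"] n
      by (simp add: mult.commute) (use l in simp)
    have "diag_char_poly n d \<noteq> 0"
      by (metis coeff_0 monic_diag_char_poly zero_neq_one)
    then show "poly (diag_char_poly n ?cd) ?s \<noteq> 0"
      by (simp add: poly_const_fract_indeterminate flip: map_poly_diag_char_poly[OF const_fract_hom])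
  qed
  then show ?thesis
    using moment_functional_resolvent_polynomial_part[where X = ?X, OF X, of p] by (auto simp: laplace)
qed

section \<open>Equivalent Coxian distributions\<close>

text \<open>The two distributions only have to share their moments, so the reduced denominator of one
  Laplace transform divides the characteristic polynomial of the other generator.\<close>

lemma denominator_dvd_char_poly:
  assumes a: "coxian_params n a da la mua" and b: "coxian_params n b db lb mub"
    and m: "cph_moment da la mua = cph_moment db lb mub"
  shows "snd (quot_of_fract (laplace_transform b)) dvd diag_char_poly n da"
proof -
  have "moment_functional (\<lambda>k. const_fract (cph_moment da la mua k))
      (map_poly const_fract (diag_char_poly n da) * r) = 0" for r
    unfolding map_poly_diag_char_poly[OF const_fract_hom] cph_moment_def
      hom_funpow_bidiag[OF const_fract_hom]
    using a by (intro moment_functional_bidiag_annihilated) (simp_all add: coxian_params_def)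
  then show ?thesis
    using laplace_annihilator[OF b] denominator_dvd_annihilator unfolding m by blast
qed

lemma equivalent_non_redundant_char_poly_eq:
  assumes a: "coxian_params n a da la mua" and b: "coxian_params n b db lb mub"
    and "non_redundant n b" and "equivalent_cph a b"
  shows "diag_char_poly n da = diag_char_poly n db"
proof -
  let ?e = "snd (quot_of_fract (laplace_transform b))"
  have "?e dvd diag_char_poly n da"
    using equivalent_cph_imp_moments_eq[OF a b assms(4)] by (rule denominator_dvd_char_poly[OF a b])
  moreover have "?e dvd diag_char_poly n db"
    using refl by (rule denominator_dvd_char_poly[OF b b])
  moreover have "degree ?e = n"
    using assms(3) by (simp only: non_redundant_def)
  ultimately show ?thesis
    using monic_eq_if_common_full_degree_divisor[of ?e "diag_char_poly n da" "diag_char_poly n db"]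
    unfolding degree_diag_char_poly monic_diag_char_poly by metis
qed

lemma diag_mat_bidiag_mat: "diag_mat (bidiag_mat n d l) = map d [0..<n]"
  by (simp add: diag_mat_def bidiag_mat_def)

text \<open>The moments give the values of the functional on the Newton basis, and the rates are
  recovered from these one state at a time.\<close>

lemma equal_diagonal_and_moments_imp_equal:
  assumes a: "coxian_params n a da la mua" and b: "coxian_params n b db lb mub"
    and m: "cph_moment da la mua = cph_moment db lb mub"
    and d: "\<And>i. i < n \<Longrightarrow> da i = db i"
  shows "a = b"
proof -
  have newton: "moment_functional (cph_moment d l mu) (diag_char_poly j d) = (\<Prod>i<j. l i) * mu j"
    for d l mu j
    using moment_functional_bidiag_newton[of d l mu j 1] by (simp add: cph_moment_def[abs_def])
  have "diag_char_poly j da = diag_char_poly j db" if "j < n" for j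
    unfolding diag_char_poly_def using that d by (intro prod.cong) auto
  then have c: "(\<Prod>i<j. la i) * mua j = (\<Prod>i<j. lb i) * mub j" if "j < n" for j
    using that newton[of da la mua j] newton[of db lb mub j] m by simp
  have rate: "la j = lb j" if "j < n" for j
    using that
  proof (induction j rule: less_induct)
    case (less j)
    have "(\<Prod>i<j. la i) = (\<Prod>i<j. lb i)" using less by (intro prod.cong) auto
    moreover have "(\<Prod>i<j. la i) > 0"
      using a less.prems by (intro prod_pos) (auto simp: coxian_params_def)
    ultimately have "mua j = mub j"
      using c[OF less.prems] by (metis less_irrefl mult_left_cancel)
    then show ?case using a b d[OF less.prems] less.prems by (simp add: coxian_params_def)
  qed
  have "bidiag_mat n da la = bidiag_mat n db lb"
    using rate d by (auto simp: bidiag_mat_def intro!: eq_matI)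
  then show ?thesis using a b by (simp add: coxian_params_def)
qed

theorem theorem2:
  fixes n :: nat and pa pb :: "real vec" and Qa Qb :: "real mat"
  assumes "is_cph n (pa, Qa)" and "is_cph n (pb, Qb)"
    and "non_redundant n (pa, Qa)" and "non_redundant n (pb, Qb)"
    and "equivalent_cph (pa, Qa) (pb, Qb)"
    and "Qa \<noteq> Qb"
  shows "(\<exists>\<pi>. \<pi> permutes {..<n} \<and> diag_mat Qb = permute_list \<pi> (diag_mat Qa))
    \<and> diag_mat Qb \<noteq> diag_mat Qa"
proof -
  obtain da la mua where a: "coxian_params n (pa, Qa) da la mua"
    using is_cph_imp_coxian_params[OF assms(1)] .
  obtain db lb mub where b: "coxian_params n (pb, Qb) db lb mub"
    using is_cph_imp_coxian_params[OF assms(2)] .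
  have diag: "diag_mat Qa = map da [0..<n]" "diag_mat Qb = map db [0..<n]"
    using a b by (simp_all add: coxian_params_def diag_mat_bidiag_mat)
  have "mset (map db [0..<n]) = mset (map da [0..<n])"
    using equivalent_non_redundant_char_poly_eq[OF a b assms(4,5)]
    by (intro diag_char_poly_eq_imp_mset_eq) simp
  then obtain \<pi> where "\<pi> permutes {..<n}" "permute_list \<pi> (diag_mat Qa) = diag_mat Qb"
    using mset_eq_permutation[of "diag_mat Qb" "diag_mat Qa"] unfolding diag by auto
  moreover have "diag_mat Qb \<noteq> diag_mat Qa"
    using equal_diagonal_and_moments_imp_equal[OF a b equivalent_cph_imp_moments_eq[OF a b assms(5)]]
      assms(6) by (auto simp: diag)
  ultimately show ?thesis by metis
qed

end
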